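(* Let $T \in \mathbb{R}^{n\times n}$ and $A = I - T$. Assume that $T \geq 0$ entrywise, that $\rho(T) < 1$, and that $\mathrm{spec}(A) \subset \mathbb{R}^+$ (all eigenvalues of $A$ are real and positive). Let $\rho = \rho(T)$ and, for $\alpha, \beta \in \mathbb{R}$, let $$T_{\alpha,\beta} = \begin{bmatrix} (1+\beta)(I - \alpha A) & -\beta I \\ I & 0 \end{bmatrix} \in \mathbb{R}^{2n \times 2n}.$$ If $$\alpha > 0 \quad \text{and} \quad |1+\beta|\,(|1-\alpha| + \alpha \rho) + |\beta| < 1,$$ then $\rho(|T_{\alpha,\beta}|) < 1$.
   Context: $\rho(\cdot)$ denotes the spectral radius and $\mathrm{spec}(\cdot)$ the set of (complex) eigenvalues of a square matrix. For a real matrix $B$, $|B|$ denotes the matrix obtained by taking the absolute value of each entry of $B$, and $B \geq 0$ means that all entries are non-negative. $I$ and $0$ in the block matrix are the $n\times n$ identity and zero matrices. $T_{\alpha,\beta}$ is the iteration matrix of the second order Richardson method $x^{k+1} = x^k + \beta(x^k - x^{k-1}) + (1+\beta)\alpha(c - A x^k)$ for solving $Ax = c$, written as a one-step recurrence for the pair $(x^{k+1}, x^k)$; the condition $\rho(|T_{\alpha,\beta}|)<1$ is the criterion for convergence of the asynchronous version of this iteration. *)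

theory Defs
  imports "Jordan_Normal_Form.Spectral_Radius"
begin

text \<open>The eigenvalues of a real matrix are its complex ones, as in \<^const>\<open>spectral_radius\<close>.\<close>

definition complex_spectrum :: "real mat \<Rightarrow> complex set" where
  "complex_spectrum B = spectrum (map_mat complex_of_real B)"

text \<open>For a \<open>0 \<times> 0\<close> matrix the spectrum is empty and this value, a \<^const>\<open>Max\<close> over the
  empty set, is unspecified; it is meaningful for square matrices of positive dimension.\<close>

definition real_spectral_radius :: "real mat \<Rightarrow> real" where
  "real_spectral_radius B = spectral_radius (map_mat complex_of_real B)"

definition abs_mat :: "real mat \<Rightarrow> real mat" where
  "abs_mat B = map_mat abs B"

definition nonneg_mat :: "real mat \<Rightarrow> bool" where
  "nonneg_mat B \<longleftrightarrow> (\<forall>i < dim_row B. \<forall>j < dim_col B. 0 \<le> B $$ (i, j))"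

text \<open>The second order Richardson method
  \<open>x\<^sub>k\<^sub>+\<^sub>1 = x\<^sub>k + \<beta> (x\<^sub>k - x\<^sub>k\<^sub>-\<^sub>1) + (1 + \<beta>) \<alpha> (c - A x\<^sub>k)\<close>
  maps the stacked vector \<open>(x\<^sub>k, x\<^sub>k\<^sub>-\<^sub>1)\<close> to \<open>(x\<^sub>k\<^sub>+\<^sub>1, x\<^sub>k)\<close> by the following matrix, plus a
  constant vector.\<close>

definition richardson_mat :: "nat \<Rightarrow> real mat \<Rightarrow> real \<Rightarrow> real \<Rightarrow> real mat" where
  "richardson_mat n A \<alpha> \<beta> =
     four_block_mat
       ((1 + \<beta>) \<cdot>\<^sub>m (1\<^sub>m n - \<alpha> \<cdot>\<^sub>m A)) ((- \<beta>) \<cdot>\<^sub>m 1\<^sub>m n)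
       (1\<^sub>m n)                         (0\<^sub>m n n)"

end

theory Submission
  imports Defs
begin

text \<open>An eigenvalue \<open>l\<close> of \<open>|T\<^sub>\<alpha>\<^sub>,\<^sub>\<beta>|\<close> with \<open>|l| \<ge> 1\<close> has an eigenvector \<open>(l v, v)\<close>. Put
  \<open>w = |l v|\<close>, so that \<open>|v| \<le> w\<close>. Since \<open>I - \<alpha> A = (1 - \<alpha>) I + \<alpha> T\<close> and \<open>T \<ge> 0\<close>, the first
  block row gives \<open>d w \<le> |1 + \<beta>| \<alpha> T w\<close> with \<open>d = 1 - |1 + \<beta>| |1 - \<alpha>| - |\<beta>|\<close>, while the
  hypothesis says \<open>d > |1 + \<beta>| \<alpha> \<rho>\<close>. This contradicts the Collatz--Wielandt bound
  \<open>s w \<le> T w \<Longrightarrow> s \<le> \<rho>(T)\<close> for nonzero \<open>w \<ge> 0\<close>.\<close>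

section \<open>Spectral radius of real matrices: sign, scaling and bounded powers\<close>

lemma real_spectral_radius_nonneg:
  assumes "B \<in> carrier_mat n n" "n > 0"
  shows "0 \<le> real_spectral_radius B"
  using spectral_radius_mem_max(1)[of "map_mat complex_of_real B" n] assms
  by (auto simp: real_spectral_radius_def)

text \<open>An eigenvalue of the scaled matrix, divided by \<open>a\<close>, is an eigenvalue of
  \<open>B\<close> with the same eigenvector. This serves to rescale a matrix until its spectral
  radius falls below 1.\<close>

lemma real_spectral_radius_smult:
  assumes B: "B \<in> carrier_mat n n" and n: "n > 0" and a: "a > 0"
  shows "real_spectral_radius (a \<cdot>\<^sub>m B) \<le> a * real_spectral_radius B"
proof -
  let ?C = "map_mat complex_of_real"
  have CB: "?C B \<in> carrier_mat n n" using B by simp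
  have eq: "?C (a \<cdot>\<^sub>m B) = complex_of_real a \<cdot>\<^sub>m ?C B" by (rule eq_matI) auto
  have "spectral_radius (?C (a \<cdot>\<^sub>m B)) \<in> norm ` spectrum (?C (a \<cdot>\<^sub>m B))"
    using spectral_radius_mem_max(1)[of "?C (a \<cdot>\<^sub>m B)" n] B n by simp
  then obtain l where sr: "spectral_radius (?C (a \<cdot>\<^sub>m B)) = norm l"
    and l: "eigenvalue (?C (a \<cdot>\<^sub>m B)) l"
    by (auto simp: spectrum_def)
  from l obtain v where v: "v \<in> carrier_vec n" "v \<noteq> 0\<^sub>v n"
    and ev: "(complex_of_real a \<cdot>\<^sub>m ?C B) *\<^sub>v v = l \<cdot>\<^sub>v v"
    using B unfolding eigenvalue_def eigenvector_def eq by auto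
  have "?C B *\<^sub>v v = (l / complex_of_real a) \<cdot>\<^sub>v v"
  proof (rule eq_vecI)
    fix i assume i: "i < dim_vec ((l / complex_of_real a) \<cdot>\<^sub>v v)"
    have "((complex_of_real a \<cdot>\<^sub>m ?C B) *\<^sub>v v) $ i = (l \<cdot>\<^sub>v v) $ i"
      by (simp add: ev)
    then have "complex_of_real a * ((?C B *\<^sub>v v) $ i) = l * v $ i"
      using i B v by (simp add: smult_scalar_prod_distrib[of _ n])
    with a show "(?C B *\<^sub>v v) $ i = ((l / complex_of_real a) \<cdot>\<^sub>v v) $ i"
      using i v by (simp add: field_simps)
  qed (use B v in auto)
  then have "l / complex_of_real a \<in> spectrum (?C B)"
    using v B by (auto simp: spectrum_def eigenvalue_def eigenvector_def)
  then have "norm (l / complex_of_real a) \<le> spectral_radius (?C B)"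
    by (intro spectral_radius_mem_max(2)[OF CB n]) auto
  with a show ?thesis
    by (simp add: real_spectral_radius_def sr norm_divide field_simps)
qed

text \<open>In the complex Jordan normal form, geometric decay beats the polynomial growth in the
  powers of each block. The embedding of the reals commutes with powers and keeps absolute values,
  so the bound returns to \<open>B\<close>.\<close>

lemma real_spectral_radius_less_1_pow_bounded:
  assumes B: "B \<in> carrier_mat n n" and sr: "real_spectral_radius B < 1"
  shows "\<exists>c. \<forall>k. \<forall>i<n. \<forall>j<n. \<bar>(B ^\<^sub>m k) $$ (i, j)\<bar> \<le> c"
proof -
  let ?C = "map_mat complex_of_real"
  have CB: "?C B \<in> carrier_mat n n" using B by simp
  obtain c where c: "\<And>k. norm_bound (?C B ^\<^sub>m k) c"
    using spectral_radius_jnf_norm_bound_less_1_upper_triangular[OF CB] sr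
    unfolding real_spectral_radius_def by blast
  have "\<bar>(B ^\<^sub>m k) $$ (i, j)\<bar> \<le> c" if "i < n" "j < n" for k i j
  proof -
    have "norm (?C (B ^\<^sub>m k) $$ (i, j)) \<le> c"
      using c[of k] that B pow_carrier_mat[OF B, of k]
      unfolding norm_bound_def by (simp add: of_real_hom.mat_hom_pow[OF B, symmetric])
    then show ?thesis using that carrier_matD[OF pow_carrier_mat[OF B, of k]] by (simp del: pow_mat_dim)
  qed
  then show ?thesis by blast
qed

section \<open>Nonnegative matrices and the Collatz-Wielandt bound\<close>

lemma mult_mat_vec_nth:
  assumes "B \<in> carrier_mat n m" "w \<in> carrier_vec m" "i < n"
  shows "(B *\<^sub>v w) $ i = (\<Sum>j<m. B $$ (i, j) * w $ j)"
  using assms by (simp add: scalar_prod_def atLeast0LessThan)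

lemma nonneg_mat_pow:
  assumes B: "B \<in> carrier_mat n n" and nn: "nonneg_mat B"
  shows "nonneg_mat (B ^\<^sub>m k)"
proof (induction k)
  case 0
  then show ?case by (simp add: nonneg_mat_def one_mat_def)
next
  case (Suc k)
  then show ?case
    using B nn pow_carrier_mat[OF B, of k]
    by (auto simp: nonneg_mat_def scalar_prod_def intro!: sum_nonneg)
qed

text \<open>Multiplication by the nonnegative matrix \<open>B ^\<^sub>m k\<close> preserves
  entrywise inequalities, so applying it to \<open>x w \<le> B w\<close> gains one more factor
  \<open>x\<close> in the induction.\<close>

lemma nonneg_pow_mult_vec_ge:
  fixes B :: "real mat"
  assumes B: "B \<in> carrier_mat n n" and nn: "nonneg_mat B" and w: "w \<in> carrier_vec n"
    and x: "x \<ge> 0" and Bw: "\<And>i. i < n \<Longrightarrow> x * w $ i \<le> (B *\<^sub>v w) $ i"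
    and i: "i < n"
  shows "x ^ k * w $ i \<le> ((B ^\<^sub>m k) *\<^sub>v w) $ i"
  using i
proof (induction k arbitrary: i)
  case 0
  then show ?case using B w by simp
next
  case (Suc k)
  note Bk = pow_carrier_mat[OF B, of k]
  have "x ^ Suc k * w $ i \<le> x * ((B ^\<^sub>m k) *\<^sub>v w) $ i"
    using mult_left_mono[OF Suc.IH[OF Suc.prems] x] by (simp add: mult.assoc)
  also have "\<dots> = (\<Sum>j<n. (B ^\<^sub>m k) $$ (i, j) * (x * w $ j))"
    by (simp add: mult_mat_vec_nth[OF Bk w Suc.prems] sum_distrib_left mult_ac)
  also have "\<dots> \<le> (\<Sum>j<n. (B ^\<^sub>m k) $$ (i, j) * (B *\<^sub>v w) $ j)"
    using nonneg_mat_pow[OF B nn, of k] carrier_matD[OF Bk] Suc.prems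
    by (intro sum_mono mult_left_mono Bw) (auto simp: nonneg_mat_def simp del: pow_mat_dim)
  also have "\<dots> = ((B ^\<^sub>m k) *\<^sub>v (B *\<^sub>v w)) $ i"
    using B w by (simp add: mult_mat_vec_nth[OF Bk _ Suc.prems])
  also have "\<dots> = ((B ^\<^sub>m Suc k) *\<^sub>v w) $ i"
    by (simp add: assoc_mult_mat_vec[OF Bk B w])
  finally show ?case .
qed

text \<open>If this failed, then for some \<open>r\<close> strictly between the
  spectral radius and \<open>s\<close> the powers of \<open>(1/r) B\<close> would be bounded, although their action
  on \<open>w\<close> grows at least like \<open>(s/r)^k\<close>.\<close>

lemma real_spectral_radius_ge:
  assumes B: "B \<in> carrier_mat n n" and nn: "nonneg_mat B" and w: "w \<in> carrier_vec n"
    and w0: "\<And>i. i < n \<Longrightarrow> 0 \<le> w $ i" and i0: "i0 < n" "w $ i0 > 0"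
    and Bw: "\<And>i. i < n \<Longrightarrow> s * w $ i \<le> (B *\<^sub>v w) $ i"
  shows "s \<le> real_spectral_radius B"
proof (rule ccontr)
  assume "\<not> s \<le> real_spectral_radius B"
  then obtain r where r: "real_spectral_radius B < r" "r < s"
    using dense[of "real_spectral_radius B" s] by auto
  have n: "n > 0" using i0 by simp
  have r0: "r > 0" using real_spectral_radius_nonneg[OF B n] r by simp
  define D where "D = (1 / r) \<cdot>\<^sub>m B"
  have D: "D \<in> carrier_mat n n" using B by (simp add: D_def)
  have "real_spectral_radius D < 1"
    unfolding D_def
  proof (rule order.strict_trans1[OF real_spectral_radius_smult[OF B n]])
    show "1 / r * real_spectral_radius B < 1" using r r0 by simp
  qed (use r0 in simp)
  then obtain c where c: "\<And>k i j. i < n \<Longrightarrow> j < n \<Longrightarrow> \<bar>(D ^\<^sub>m k) $$ (i, j)\<bar> \<le> c"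
    using real_spectral_radius_less_1_pow_bounded[OF D] by blast
  have Dw: "s / r * w $ i \<le> (D *\<^sub>v w) $ i" if "i < n" for i
    using Bw[OF that] r0 B w that
    by (simp add: D_def smult_scalar_prod_distrib[of _ n] divide_right_mono)
  have nnD: "nonneg_mat D" using nn r0 by (auto simp: D_def nonneg_mat_def)
  \<comment> \<open>The threshold is the largest value that the entry bound \<open>c\<close> allows
    for component \<open>i0\<close> of \<open>D ^\<^sub>m k\<close> applied to \<open>w\<close>,
    divided by \<open>w $ i0\<close>; as \<open>s / r > 1\<close>, some power exceeds it.\<close>
  obtain k where k: "(\<Sum>j<n. c * w $ j) / w $ i0 < (s / r) ^ k"
    using real_arch_pow[of "s / r"] r r0 by auto
  have "(s / r) ^ k * w $ i0 \<le> ((D ^\<^sub>m k) *\<^sub>v w) $ i0"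
    using nonneg_pow_mult_vec_ge[OF D nnD w _ Dw i0(1)] r r0 by simp
  also have "\<dots> = (\<Sum>j<n. (D ^\<^sub>m k) $$ (i0, j) * w $ j)"
    by (rule mult_mat_vec_nth[OF pow_carrier_mat[OF D] w i0(1)])
  also have "\<dots> \<le> (\<Sum>j<n. c * w $ j)"
    using c[OF i0(1)] w0 by (intro sum_mono mult_right_mono) (auto intro: order_trans[OF abs_ge_self])
  finally show False using k i0(2) by (simp add: field_simps)
qed

section \<open>The iteration matrix and the contradiction\<close>

lemma abs_richardson_mat:
  assumes "A \<in> carrier_mat n n"
  shows "abs_mat (richardson_mat n A \<alpha> \<beta>) =
    four_block_mat (abs_mat ((1 + \<beta>) \<cdot>\<^sub>m (1\<^sub>m n - \<alpha> \<cdot>\<^sub>m A))) (\<bar>\<beta>\<bar> \<cdot>\<^sub>m 1\<^sub>m n) (1\<^sub>m n) (0\<^sub>m n n)"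
  using assms unfolding richardson_mat_def abs_mat_def
  by (intro eq_matI) (auto simp: one_mat_def)

theorem theorem4p2:
  fixes n :: nat and T A :: "real mat" and \<rho> \<alpha> \<beta> :: real
  assumes "n \<ge> 1"
    and "T \<in> carrier_mat n n"
    and "A = 1\<^sub>m n - T"
    and "nonneg_mat T"
    and "real_spectral_radius T < 1"
    and "\<forall>z \<in> complex_spectrum A. z \<in> \<real> \<and> Re z > 0"
    and "\<rho> = real_spectral_radius T"
    and "\<alpha> > 0"
    and "\<bar>1 + \<beta>\<bar> * (\<bar>1 - \<alpha>\<bar> + \<alpha> * \<rho>) + \<bar>\<beta>\<bar> < 1"
  shows "real_spectral_radius (abs_mat (richardson_mat n A \<alpha> \<beta>)) < 1"
proof (rule ccontr)
  assume not_less: "\<not> ?thesis"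
  let ?C = "map_mat complex_of_real"
  define P where "P = abs_mat ((1 + \<beta>) \<cdot>\<^sub>m (1\<^sub>m n - \<alpha> \<cdot>\<^sub>m A))"
  define M where "M = abs_mat (richardson_mat n A \<alpha> \<beta>)"
  note T = assms(2)
  have A: "A \<in> carrier_mat n n" unfolding assms(3) using T by (rule minus_carrier_mat)
  have P: "P \<in> carrier_mat n n" using A by (intro carrier_matI) (simp_all add: P_def abs_mat_def)
  have M_eq: "M = four_block_mat P (\<bar>\<beta>\<bar> \<cdot>\<^sub>m 1\<^sub>m n) (1\<^sub>m n) (0\<^sub>m n n)"
    unfolding M_def P_def by (rule abs_richardson_mat[OF A])
  have CM_eq: "?C M = four_block_mat (?C P) (complex_of_real \<bar>\<beta>\<bar> \<cdot>\<^sub>m 1\<^sub>m n) (1\<^sub>m n) (0\<^sub>m n n)"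
    unfolding M_eq using P by (intro eq_matI) (auto simp: one_mat_def)
  have CM: "?C M \<in> carrier_mat (n + n) (n + n)"
    unfolding CM_eq using P by auto
  \<comment> \<open>The dimension is positive, so the spectral radius is attained at some eigenvalue
    \<open>l\<close>, which the negated claim places outside the open unit disc.\<close>
  have "spectral_radius (?C M) \<in> norm ` spectrum (?C M)"
    using spectral_radius_mem_max(1)[OF CM] assms(1) by simp
  then obtain l where sr: "spectral_radius (?C M) = norm l" and l: "eigenvalue (?C M) l"
    by (auto simp: spectrum_def)
  have l1: "norm l \<ge> 1"
    using not_less sr by (simp add: M_def real_spectral_radius_def)
  from l CM obtain z where z: "z \<in> carrier_vec (n + n)" "z \<noteq> 0\<^sub>v (n + n)"
    and ev: "?C M *\<^sub>v z = l \<cdot>\<^sub>v z"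
    unfolding eigenvalue_def eigenvector_def by auto
  define u where "u = vec_first z n"
  define v where "v = vec_last z n"
  have u: "u \<in> carrier_vec n" and v: "v \<in> carrier_vec n" by (auto simp: u_def v_def)
  have z_eq: "z = u @\<^sub>v v" using z(1) by (simp add: u_def v_def)
  have "?C M *\<^sub>v (u @\<^sub>v v) =
      (?C P *\<^sub>v u + (complex_of_real \<bar>\<beta>\<bar> \<cdot>\<^sub>m 1\<^sub>m n) *\<^sub>v v) @\<^sub>v (1\<^sub>m n *\<^sub>v u + 0\<^sub>m n n *\<^sub>v v)"
    unfolding CM_eq by (rule four_block_mat_mult_vec) (use P u v in auto)
  moreover have "l \<cdot>\<^sub>v (u @\<^sub>v v) = (l \<cdot>\<^sub>v u) @\<^sub>v (l \<cdot>\<^sub>v v)"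
    using u v by (intro eq_vecI) auto
  ultimately have "(?C P *\<^sub>v u + (complex_of_real \<bar>\<beta>\<bar> \<cdot>\<^sub>m 1\<^sub>m n) *\<^sub>v v) @\<^sub>v
      (1\<^sub>m n *\<^sub>v u + 0\<^sub>m n n *\<^sub>v v) = (l \<cdot>\<^sub>v u) @\<^sub>v (l \<cdot>\<^sub>v v)"
    using ev unfolding z_eq by simp
  then have "?C P *\<^sub>v u + (complex_of_real \<bar>\<beta>\<bar> \<cdot>\<^sub>m 1\<^sub>m n) *\<^sub>v v = l \<cdot>\<^sub>v u \<and>
      1\<^sub>m n *\<^sub>v u + 0\<^sub>m n n *\<^sub>v v = l \<cdot>\<^sub>v v"
    by (rule iffD1[OF append_vec_eq[of _ n], rotated 2]) (use P u v in \<open>auto intro!: carrier_vecI\<close>)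
  then have top: "?C P *\<^sub>v u + (complex_of_real \<bar>\<beta>\<bar> \<cdot>\<^sub>m 1\<^sub>m n) *\<^sub>v v = l \<cdot>\<^sub>v u"
    and bot: "1\<^sub>m n *\<^sub>v u + 0\<^sub>m n n *\<^sub>v v = l \<cdot>\<^sub>v v"
    by auto
  have "0\<^sub>m n n *\<^sub>v v = 0\<^sub>v n" using v by (intro eq_vecI) auto
  with bot u have uv: "u = l \<cdot>\<^sub>v v" by simp
  have top_nth: "l * u $ i = (\<Sum>j<n. complex_of_real (P $$ (i, j)) * u $ j) + \<bar>\<beta>\<bar> * v $ i"
    if "i < n" for i
  proof -
    have "(?C P *\<^sub>v u + (complex_of_real \<bar>\<beta>\<bar> \<cdot>\<^sub>m 1\<^sub>m n) *\<^sub>v v) $ i = (l \<cdot>\<^sub>v u) $ i"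
      by (simp add: top)
    moreover have "(?C P *\<^sub>v u) $ i = (\<Sum>j<n. complex_of_real (P $$ (i, j)) * u $ j)"
      using that P u by (subst mult_mat_vec_nth[of _ n n]) auto
    ultimately show ?thesis
      using that P u v by (simp add: smult_scalar_prod_distrib[of _ n])
  qed
  \<comment> \<open>Moduli are taken of the upper block \<open>u\<close>, the larger one:
    \<open>norm l \<ge> 1\<close> then gives both \<open>w \<le> norm (l * u)\<close> and
    \<open>norm v \<le> w\<close>, which absorbs the \<open>\<beta>\<close> term.\<close>
  define w where "w = map_vec norm u"
  have w: "w \<in> carrier_vec n" using u by (simp add: w_def)
  have w_nth: "w $ i = norm (u $ i)" if "i < n" for i using that u by (simp add: w_def)
  have v_le: "norm (v $ i) \<le> w $ i" if "i < n" for i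
    using that v l1 mult_right_mono[OF l1 norm_ge_zero, of "v $ i"] by (simp add: w_nth uv norm_mult)
  obtain i0 where i0: "i0 < n" "w $ i0 > 0"
  proof -
    \<comment> \<open>If \<open>u\<close> vanished, \<open>v_le\<close> would force
      \<open>v\<close>, and hence the eigenvector \<open>z\<close>, to vanish.\<close>
    have "u \<noteq> 0\<^sub>v n"
    proof
      assume u0: "u = 0\<^sub>v n"
      have "v = 0\<^sub>v n"
      proof (rule eq_vecI)
        fix i assume "i < dim_vec (0\<^sub>v n :: complex vec)"
        then show "v $ i = 0\<^sub>v n $ i" using v_le[of i] u0 by (simp add: w_nth)
      qed (use v in simp)
      with u0 z(2) show False by (auto simp: z_eq)
    qed
    then obtain i where "i < n" "u $ i \<noteq> 0"
      using u by (metis carrier_vecD eq_vecI index_zero_vec(1) index_zero_vec(2))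
    then show thesis using that[of i] by (simp add: w_nth)
  qed
  define c where "c = \<bar>1 + \<beta>\<bar>"
  \<comment> \<open>What remains of the coefficient of \<open>w\<close> once the diagonal part of
    \<open>P\<close> and the \<open>\<beta>\<close> term are moved to the left-hand side.\<close>
  define d where "d = 1 - c * \<bar>1 - \<alpha>\<bar> - \<bar>\<beta>\<bar>"
  have d_less: "c * \<alpha> * \<rho> < d" using assms(9) by (simp add: d_def c_def algebra_simps)
  \<comment> \<open>The triangle inequality separates the diagonal part from
    \<open>\<alpha> T\<close>, whose entries equal their absolute values because
    \<open>\<alpha> > 0\<close> and \<open>T\<close> is nonnegative.\<close>
  have P_le: "P $$ (i, j) \<le> c * \<bar>1 - \<alpha>\<bar> * (if i = j then 1 else 0) + c * \<alpha> * T $$ (i, j)"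
    if "i < n" "j < n" for i j
  proof -
    have "P $$ (i, j) = c * \<bar>(1 - \<alpha>) * (if i = j then 1 else 0) + \<alpha> * T $$ (i, j)\<bar>"
      using that T unfolding c_def abs_mult[symmetric]
      by (simp add: P_def abs_mat_def assms(3) algebra_simps)
    also have "\<dots> \<le> c * (\<bar>(1 - \<alpha>) * (if i = j then 1 else 0)\<bar> + \<bar>\<alpha> * T $$ (i, j)\<bar>)"
      by (intro mult_left_mono abs_triangle_ineq) (simp add: c_def)
    also have "\<dots> = c * \<bar>1 - \<alpha>\<bar> * (if i = j then 1 else 0) + c * \<alpha> * T $$ (i, j)"
      using that T assms(4,8) by (simp add: nonneg_mat_def abs_mult algebra_simps)
    finally show ?thesis .
  qed
  have dw: "d * w $ i \<le> c * \<alpha> * (T *\<^sub>v w) $ i" if i: "i < n" for i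
  proof -
    have "w $ i \<le> norm (l * u $ i)"
      using mult_right_mono[OF l1 norm_ge_zero, of "u $ i"] i by (simp add: w_nth norm_mult)
    also have "\<dots> \<le> (\<Sum>j<n. P $$ (i, j) * w $ j) + \<bar>\<beta>\<bar> * w $ i"
      unfolding top_nth[OF i]
    proof (intro norm_triangle_le add_mono sum_norm_le)
      show "norm (complex_of_real (P $$ (i, j)) * u $ j) \<le> P $$ (i, j) * w $ j" if "j \<in> {..<n}" for j
        using that i A by (simp add: norm_mult w_nth P_def abs_mat_def)
      show "norm (complex_of_real \<bar>\<beta>\<bar> * v $ i) \<le> \<bar>\<beta>\<bar> * w $ i"
        using v_le[OF i] by (simp add: norm_mult mult_left_mono)
    qed
    also have "(\<Sum>j<n. P $$ (i, j) * w $ j) \<le>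
        (\<Sum>j<n. (c * \<bar>1 - \<alpha>\<bar> * (if i = j then 1 else 0) + c * \<alpha> * T $$ (i, j)) * w $ j)"
      using P_le[OF i] by (intro sum_mono mult_right_mono) (auto simp: w_nth)
    also have "\<dots> = c * \<bar>1 - \<alpha>\<bar> * (\<Sum>j<n. if i = j then w $ j else 0) + c * \<alpha> * (T *\<^sub>v w) $ i"
      unfolding mult_mat_vec_nth[OF T w i] sum_distrib_left sum.distrib[symmetric]
      by (intro sum.cong) (auto simp: algebra_simps)
    also have "(\<Sum>j<n. if i = j then w $ j else 0) = w $ i"
      using i by simp
    finally show ?thesis by (simp add: d_def algebra_simps)
  qed
  have c0: "c \<ge> 0" by (simp add: c_def)
  show False
  \<comment> \<open>The final division by \<open>c * \<alpha>\<close> excludes \<open>c = 0\<close>,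
    that is \<open>\<beta> = -1\<close>. In that case \<open>dw\<close> gives
    \<open>d * w $ i0 \<le> 0\<close>, although \<open>d\<close> and \<open>w $ i0\<close> are
    positive.\<close>
  proof (cases "c = 0")
    case True
    then show False using dw[OF i0(1)] d_less i0(2) by (simp add: mult_le_0_iff)
  next
    case False
    then have ca: "c * \<alpha> > 0" using c0 assms(8) by simp
    have "d / (c * \<alpha>) \<le> \<rho>"
      unfolding assms(7)
    proof (rule real_spectral_radius_ge[OF T assms(4) w _ i0])
      show "d / (c * \<alpha>) * w $ i \<le> (T *\<^sub>v w) $ i" if "i < n" for i
        using dw[OF that] ca by (simp add: pos_divide_le_eq mult_ac)
    qed (simp add: w_nth)
    then show False using d_less ca by (simp add: pos_divide_le_eq mult_ac)
  qed
qed

end
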